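(* Suppose that a point cloud $X^0=\{x_i^0\}_{i=1}^N\subset\mathbb{R}^n$ is contained in a ball of radius $R^0$ centered at $z\in\mathbb{R}^n$ (i.e. $|x_i^0-z|\le R^0$ for all $i$), and assume that $(V^k)_k$, $V^k=\sum_{i=1}^Nm_i^k\,\delta_{(x_i^k,P_i^k)}$, is a sequence of point cloud varifolds which are solutions of the implicit scheme $$x_i^{k+1}=x_i^k+\tau\,H_\varepsilon^\Pi\bigl(x_i^{k+1},\widehat{V^k}\bigr),\qquad\widehat{V^k}=\sum_{i=1}^Nm_i^k\,\delta_{(x_i^{k+1},P_i^k)},\qquad i=1,\dots,N,$$ with time step $\tau>0$. For $k\ge1$ define $R^k=\max_{i\in\{1,\dots,N\}}|x_i^k-z|$, and for $k\ge0$ define $$c^k=\min\left\{\frac{\Pi_{ij}^k(x_i^{k+1}-x_j^{k+1})\cdot(x_i^{k+1}-z)}{|x_i^{k+1}-x_j^{k+1}|^2}\ :\ i,j\in\{1,\dots,N\},\ |x_i^{k+1}-z|=R^{k+1},\ 0<|x_i^{k+1}-x_j^{k+1}|<\varepsilon\right\}.$$ Then, independently of the choices of the masses $m_i^k>0$, for all $k$ such that $V^k$ is defined, the positions $\{x_j^k\}_{j=1}^N$ are contained in the (closed) ball of center $z$ and radius $$\sqrt{(R^0)^2-2d\,\tau\sum_{l=0}^{k-1}c^l}.$$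
   Context: $1\le d\le n$ are integers, $\varepsilon>0$. $\rho,\xi\in C^\infty(\mathbb{R})$ are fixed nonnegative even functions, compactly supported in $[-1,1]$, positive on $(0,1)$, $\rho$ nonincreasing on $[0,1]$, with $n\,\xi(s)=-s\,\rho'(s)$ for $s\in(-1,1)$. Masses $m_i^k=m_i(X^k)>0$ and directions $P_i^k=P_i(X^k)$ ($d$-dimensional linear subspaces of $\mathbb{R}^n$) are computed from the positions $X^k=(x_1^k,\dots,x_N^k)$ by a prescribed rule. $\Pi_P$ is the orthogonal projector onto $P$, and $\Pi_{ij}^k$ is one fixed choice among $$\Pi_{P_j},\quad-2\Pi_{P_j^\perp},\quad2\,\mathrm{Id},\quad\Pi_{P_i^\perp}\circ\Pi_{P_j},\quad-2\Pi_{P_i^\perp}\circ\Pi_{P_j^\perp},\quad2\Pi_{P_i^\perp}$$ evaluated at $P_i=P_i^k$, $P_j=P_j^k$. Explicitly, the scheme reads $$x_i^{k+1}=x_i^k-\frac{\tau d}{n\varepsilon}\,\frac{\sum_{j\ne i}m_j^k\,\rho'\!\left(\frac{|x_j^{k+1}-x_i^{k+1}|}{\varepsilon}\right)\Pi_{ij}^k\!\left(\frac{x_j^{k+1}-x_i^{k+1}}{|x_j^{k+1}-x_i^{k+1}|}\right)}{\sum_{l=1}^Nm_l^k\,\xi\!\left(\frac{|x_l^{k+1}-x_i^{k+1}|}{\varepsilon}\right)},$$ where the denominators are understood to be positive and terms with $x_j^{k+1}=x_i^{k+1}$ are zero. *)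

theory Defs
  imports "HOL-Analysis.Analysis" "HOL-Library.Extended_Nat"
begin

definition smooth_real :: "(real \<Rightarrow> real) \<Rightarrow> bool" where
  "smooth_real f \<longleftrightarrow> (\<forall>k. (deriv ^^ k) f differentiable_on UNIV)"

definition profile :: "(real \<Rightarrow> real) \<Rightarrow> bool" where
  "profile f \<longleftrightarrow> smooth_real f \<and> (\<forall>s. 0 \<le> f s) \<and> (\<forall>s. f (- s) = f s) \<and>
     closure {s. f s \<noteq> 0} \<subseteq> {-1..1} \<and> (\<forall>s\<in>{0<..<1}. 0 < f s)"

definition profile_pair :: "nat \<Rightarrow> (real \<Rightarrow> real) \<Rightarrow> (real \<Rightarrow> real) \<Rightarrow> bool" where
  "profile_pair n \<rho> \<xi> \<longleftrightarrow> profile \<rho> \<and> profile \<xi> \<and> antimono_on {0..1} \<rho> \<and>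
     (\<forall>s\<in>{-1<..<1}. real n * \<xi> s = - s * deriv \<rho> s)"

definition orth_proj :: "(real ^ 'n) set \<Rightarrow> real ^ 'n \<Rightarrow> real ^ 'n" where
  "orth_proj P x = (THE y. y \<in> P \<and> (\<forall>v\<in>P. orthogonal (x - y) v))"

text \<open>The admissible choices of the map written \<open>\<Pi>\<^sub>i\<^sub>j\<close>, as functions of the two planes
  \<open>P = P\<^sub>i\<close> and \<open>Q = P\<^sub>j\<close>.\<close>

definition proj_choices ::
  "((real ^ 'n) set \<Rightarrow> (real ^ 'n) set \<Rightarrow> real ^ 'n \<Rightarrow> real ^ 'n) set" where
  "proj_choices =
    {\<lambda>P Q v. orth_proj Q v,
     \<lambda>P Q v. - 2 *\<^sub>R orth_proj (orthogonal_comp Q) v,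
     \<lambda>P Q v. 2 *\<^sub>R v,
     \<lambda>P Q v. orth_proj (orthogonal_comp P) (orth_proj Q v),
     \<lambda>P Q v. - 2 *\<^sub>R orth_proj (orthogonal_comp P) (orth_proj (orthogonal_comp Q) v),
     \<lambda>P Q v. 2 *\<^sub>R orth_proj (orthogonal_comp P) v}"

text \<open>A point cloud varifold \<open>\<Sum>\<^sub>i m\<^sub>i \<delta>\<^bsub>(x\<^sub>i, P\<^sub>i)\<^esub>\<close> is kept as its labelled family of atoms: the
  evolution acts on labelled points, and distinct labels may share a position. The number
  \<open>N\<close> of points is \<open>CARD('m)\<close>.\<close>

record ('n, 'm) point_cloud =
  pos :: "'m \<Rightarrow> real ^ 'n"
  mass :: "'m \<Rightarrow> real"
  plane :: "'m \<Rightarrow> (real ^ 'n) set"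

definition point_cloud_varifold :: "nat \<Rightarrow> ('n::finite, 'm::finite) point_cloud \<Rightarrow> bool" where
  "point_cloud_varifold d V \<longleftrightarrow>
     (\<forall>i. 0 < mass V i \<and> subspace (plane V i) \<and> dim (plane V i) = d)"

definition curv_denom ::
  "real \<Rightarrow> (real \<Rightarrow> real) \<Rightarrow> ('n::finite, 'm::finite) point_cloud \<Rightarrow> 'm \<Rightarrow> real" where
  "curv_denom \<epsilon> \<xi> V i = (\<Sum>l\<in>UNIV. mass V l * \<xi> (norm (pos V l - pos V i) / \<epsilon>))"

text \<open>The approximate mean curvature \<open>H\<^sub>\<epsilon>\<^sup>\<Pi>(x\<^sub>i, V)\<close>; it is indexed by the label \<open>i\<close> rather than by
  the point \<open>x\<^sub>i\<close> because \<open>\<Pi>\<close> may also depend on the plane \<open>P\<^sub>i\<close>.\<close>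

definition curv ::
  "nat \<Rightarrow> real \<Rightarrow> (real \<Rightarrow> real) \<Rightarrow> (real \<Rightarrow> real) \<Rightarrow>
   ((real ^ 'n) set \<Rightarrow> (real ^ 'n) set \<Rightarrow> real ^ 'n \<Rightarrow> real ^ 'n) \<Rightarrow>
   ('n::finite, 'm::finite) point_cloud \<Rightarrow> 'm \<Rightarrow> real ^ 'n" where
  "curv d \<epsilon> \<rho> \<xi> Pr V i =
     - ((real d / (real CARD('n) * \<epsilon>)) *\<^sub>R
        ((\<Sum>j | j \<noteq> i \<and> pos V j \<noteq> pos V i.
            (mass V j * deriv \<rho> (norm (pos V j - pos V i) / \<epsilon>)) *\<^sub>R
              Pr (plane V i) (plane V j) ((pos V j - pos V i) /\<^sub>R norm (pos V j - pos V i)))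
         /\<^sub>R curv_denom \<epsilon> \<xi> V i))"

text \<open>The cloud with the masses and planes of \<open>V\<close> and the positions of \<open>W\<close>.\<close>

definition hat :: "('n::finite, 'm::finite) point_cloud \<Rightarrow> ('n, 'm) point_cloud \<Rightarrow>
    ('n, 'm) point_cloud" where
  "hat V W = V\<lparr>pos := pos W\<rparr>"

definition implicit_step ::
  "nat \<Rightarrow> real \<Rightarrow> (real \<Rightarrow> real) \<Rightarrow> (real \<Rightarrow> real) \<Rightarrow>
   ((real ^ 'n) set \<Rightarrow> (real ^ 'n) set \<Rightarrow> real ^ 'n \<Rightarrow> real ^ 'n) \<Rightarrow> real \<Rightarrow>
   ('n::finite, 'm::finite) point_cloud \<Rightarrow> ('n, 'm) point_cloud \<Rightarrow> bool" where
  "implicit_step d \<epsilon> \<rho> \<xi> Pr \<tau> V W \<longleftrightarrow>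
     (\<forall>i. 0 < curv_denom \<epsilon> \<xi> (hat V W) i \<and>
          pos W i = pos V i + \<tau> *\<^sub>R curv d \<epsilon> \<rho> \<xi> Pr (hat V W) i)"

definition max_radius :: "real ^ 'n \<Rightarrow> ('n::finite, 'm::finite) point_cloud \<Rightarrow> real" where
  "max_radius z V = Max (range (\<lambda>i. norm (pos V i - z)))"

text \<open>With \<open>U = hat (V k) (V (Suc k))\<close> this is the constant \<open>c\<^sup>k\<close>. The set below is nonempty whenever
  all denominators \<open>curv_denom \<epsilon> \<xi> U i\<close> are positive, since \<open>\<xi>\<close> vanishes at \<open>0\<close> and outside
  \<open>(-1, 1)\<close>; hence the value of \<open>Min\<close> on the empty set plays no role.\<close>

definition min_ratio ::
  "real \<Rightarrow> ((real ^ 'n) set \<Rightarrow> (real ^ 'n) set \<Rightarrow> real ^ 'n \<Rightarrow> real ^ 'n) \<Rightarrow> real ^ 'n \<Rightarrow>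
   ('n::finite, 'm::finite) point_cloud \<Rightarrow> real" where
  "min_ratio \<epsilon> Pr z U =
     Min {(Pr (plane U i) (plane U j) (pos U i - pos U j) \<bullet> (pos U i - z))
            / (norm (pos U i - pos U j))\<^sup>2 | i j.
          norm (pos U i - z) = max_radius z U \<and>
          0 < norm (pos U i - pos U j) \<and> norm (pos U i - pos U j) < \<epsilon>}"

end

theory Submission imports Defs begin

text \<open>At a farthest point \<open>x\<^sub>i\<close> of the new cloud, \<open>n \<xi>(s) = - s \<rho>'(s)\<close> turns
  \<open>H \<bullet> (x\<^sub>i - z)\<close> into \<open>- d\<close> times an average of the ratios in the definition of \<open>c\<^sup>k\<close>, with weights
  \<open>m\<^sub>j \<xi>(\<bar>x\<^sub>j - x\<^sub>i\<bar> / \<epsilon>)\<close>; hence it is at most \<open>- d c\<^sup>k\<close>. Since the old position is the new one minus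
  \<open>\<tau> H\<close>, expanding the square gives \<open>(R\<^sup>k)\<^sup>2 \<ge> (R\<^sup>k\<^sup>+\<^sup>1)\<^sup>2 + 2 d \<tau> c\<^sup>k\<close>.\<close>

section \<open>Orthogonal projections and homogeneity of the choices of \<open>Pr\<close>\<close>

lemma orth_proj_eqI:
  assumes "subspace P" "y \<in> P" "\<And>v. v \<in> P \<Longrightarrow> orthogonal (x - y) v"
  shows "orth_proj P x = y"
  unfolding orth_proj_def
proof (rule the_equality)
  fix w assume w: "w \<in> P \<and> (\<forall>v\<in>P. orthogonal (x - w) v)"
  then have "w - y \<in> P"
    using assms by (simp add: subspace_diff)
  then have "(x - y) \<bullet> (w - y) = 0" "(x - w) \<bullet> (w - y) = 0"
    using w assms(3) by (auto simp: orthogonal_def)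
  then have "(w - y) \<bullet> (w - y) = 0"
    by (simp add: inner_diff_left)
  then show "w = y" by simp
qed (use assms in auto)

lemma orth_proj_props:
  assumes "subspace P"
  shows "orth_proj P x \<in> P" and "v \<in> P \<Longrightarrow> orthogonal (x - orth_proj P x) v"
proof -
  obtain y w where "y \<in> span P" "\<And>v. v \<in> span P \<Longrightarrow> orthogonal w v" "x = y + w"
    using orthogonal_subspace_decomp_exists by blast
  then have y: "y \<in> P" "\<And>v. v \<in> P \<Longrightarrow> orthogonal (x - y) v"
    by (auto simp: span_eq_iff[THEN iffD2, OF assms])
  with orth_proj_eqI[OF assms] have "orth_proj P x = y" by blast
  with y show "orth_proj P x \<in> P" "v \<in> P \<Longrightarrow> orthogonal (x - orth_proj P x) v"
    by auto
qed

lemma orth_proj_scaleR: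
  assumes "subspace P"
  shows "orth_proj P (a *\<^sub>R x) = a *\<^sub>R orth_proj P x"
proof (rule orth_proj_eqI[OF assms])
  show "a *\<^sub>R orth_proj P x \<in> P"
    using assms by (simp add: orth_proj_props(1) subspace_scale)
  fix v assume "v \<in> P"
  then show "orthogonal (a *\<^sub>R x - a *\<^sub>R orth_proj P x) v"
    using orth_proj_props(2)[OF assms, of v x]
    by (simp add: orthogonal_def flip: scaleR_diff_right)
qed

text \<open>The estimate uses the choices through homogeneity alone: it carries the unit vector from
  x_i to x_j in the curvature over to the vector x_i - x_j in c^k, including the change of
  sign.\<close>

lemma proj_choices_scaleR:
  assumes "Pr \<in> proj_choices" "subspace P" "subspace Q"
  shows "Pr P Q (a *\<^sub>R v) = a *\<^sub>R Pr P Q v"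
  using assms
  by (auto simp: proj_choices_def orth_proj_scaleR subspace_orthogonal_comp mult.commute)

section \<open>Profiles at and beyond the edge of their support\<close>

lemma profile_differentiable:
  assumes "profile f"
  shows "f differentiable (at s)"
proof -
  have "(deriv ^^ 0) f differentiable_on UNIV"
    using assms unfolding profile_def smooth_real_def by blast
  then show ?thesis
    by (simp add: differentiable_on_def)
qed

text \<open>The support condition alone gives zeros only for s > 1; the endpoint s = 1 follows by
  continuity from the right.\<close>

lemma profile_eq_0:
  assumes "profile f" "1 \<le> s"
  shows "f s = 0"
proof -
  have out: "f t = 0" if "1 < t" for t
  proof (rule ccontr)
    assume "f t \<noteq> 0"
    then have "t \<in> {-1..1}"
      using assms(1) closure_subset[of "{s. f s \<noteq> 0}"] by (auto simp: profile_def)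
    with that show False by simp
  qed
  have "continuous (at s) f"
    using profile_differentiable[OF assms(1)] by (rule differentiable_imp_continuous_within)
  then have "(f \<longlongrightarrow> f s) (at_right s)"
    unfolding continuous_within by (rule tendsto_within_subset) simp
  moreover have "(f \<longlongrightarrow> 0) (at_right s)"
  proof (rule tendsto_eventually)
    show "\<forall>\<^sub>F t in at_right s. f t = 0"
      using eventually_at_right_less[of s] by eventually_elim (use assms(2) out in auto)
  qed
  ultimately show ?thesis
    using tendsto_unique trivial_limit_at_right_real by blast
qed

text \<open>A zero of a nonnegative function is a global minimum, so the derivative vanishes there.
  This treats s = 1 together with s > 1.\<close>

lemma profile_deriv_eq_0:
  assumes "profile f" "1 \<le> s"
  shows "deriv f s = 0"
proof -
  have "DERIV f s :> deriv f s"
    using profile_differentiable[OF assms(1)]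
    by (metis DERIV_imp_deriv real_differentiable_def)
  moreover have "f s \<le> f t" for t
    using profile_eq_0[OF assms] assms(1) by (simp add: profile_def)
  ultimately show ?thesis
    using DERIV_local_min[of f _ s 1] by auto
qed

text \<open>Past 1 both sides vanish, so the relation assumed on (-1,1) holds at every scaled
  distance and pairs far apart need no separate substitution.\<close>

lemma profile_pair_deriv:
  assumes "profile_pair n \<rho> \<xi>" "0 \<le> s"
  shows "s * deriv \<rho> s = - (real n * \<xi> s)"
proof (cases "s < 1")
  case True
  then show ?thesis
    using assms by (auto simp: profile_pair_def)
next
  case False
  then show ?thesis
    using assms profile_eq_0[of \<xi> s] profile_deriv_eq_0[of \<rho> s]
    by (simp add: profile_pair_def)
qed

section \<open>The curvature at a farthest point\<close>

lemma min_ratio_le: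
  assumes "norm (pos U i - z) = max_radius z U"
    and "0 < norm (pos U i - pos U j)" "norm (pos U i - pos U j) < \<epsilon>"
  shows "min_ratio \<epsilon> Pr z U
    \<le> (Pr (plane U i) (plane U j) (pos U i - pos U j) \<bullet> (pos U i - z))
        / (norm (pos U i - pos U j))\<^sup>2"
proof -
  \<comment> \<open>Finitely many pairs of labels make the set finite, without which
    \<open>Min\<close> gives no bound.\<close>
  let ?g = "\<lambda>(i, j). (Pr (plane U i) (plane U j) (pos U i - pos U j) \<bullet> (pos U i - z))
            / (norm (pos U i - pos U j))\<^sup>2"
  show ?thesis
    unfolding min_ratio_def
  proof (rule Min_le)
    show "finite {(Pr (plane U i) (plane U j) (pos U i - pos U j) \<bullet> (pos U i - z))
            / (norm (pos U i - pos U j))\<^sup>2 | i j.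
          norm (pos U i - z) = max_radius z U \<and>
          0 < norm (pos U i - pos U j) \<and> norm (pos U i - pos U j) < \<epsilon>}"
      by (rule finite_subset[of _ "range ?g"]) auto
  qed (use assms in blast)
qed

text \<open>\<open>far\<close> gives access to the minimum c^k, which may have either sign.
  \<open>hom\<close> is restricted to the planes of \<open>U\<close> because projections are known
  to be homogeneous only for subspaces.\<close>

lemma curv_inner_le:
  fixes U :: "('n::finite, 'm::finite) point_cloud"
  assumes eps: "0 < \<epsilon>" and pp: "profile_pair CARD('n) \<rho> \<xi>"
    and hom: "\<And>i j a v. Pr (plane U i) (plane U j) (a *\<^sub>R v) = a *\<^sub>R Pr (plane U i) (plane U j) v"
    and mass: "\<And>i. 0 < mass U i"
    and den: "0 < curv_denom \<epsilon> \<xi> U i"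
    and far: "norm (pos U i - z) = max_radius z U"
  shows "curv d \<epsilon> \<rho> \<xi> Pr U i \<bullet> (pos U i - z) \<le> - (real d * min_ratio \<epsilon> Pr z U)"
proof -
  define J where "J = {j. j \<noteq> i \<and> pos U j \<noteq> pos U i}"
  define r where "r j = norm (pos U j - pos U i)" for j
  define w where "w j = mass U j * \<xi> (r j / \<epsilon>)" for j
  define q where "q j = (Pr (plane U i) (plane U j) (pos U i - pos U j) \<bullet> (pos U i - z)) / (r j)\<^sup>2"
    for j
  let ?n = "real CARD('n)" and ?c = "min_ratio \<epsilon> Pr z U" and ?D = "curv_denom \<epsilon> \<xi> U i"
  have xi0: "\<xi> 0 = 0"
    using profile_pair_deriv[OF pp, of 0] by simp
  have xi_nonneg: "0 \<le> \<xi> s" for s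
    using pp by (simp add: profile_pair_def profile_def)
  \<comment> \<open>Since \<xi>(0) = 0, the label i and all labels at the same position drop out of
    the denominator, which thus becomes the total weight over the index set of the
    numerator.\<close>
  have D: "?D = (\<Sum>j\<in>J. w j)"
    unfolding curv_denom_def w_def r_def
    by (rule sum.mono_neutral_right) (auto simp: J_def xi0)
  \<comment> \<open>The minus sign of \<rho>' cancels the one from reversing x_j - x_i, and the
    powers of r cancel; the remaining factor n \<epsilon> cancels against the prefactor d / (n
    \<epsilon>).\<close>
  have summand: "(mass U j * deriv \<rho> (r j / \<epsilon>)) *
      (Pr (plane U i) (plane U j) ((pos U j - pos U i) /\<^sub>R r j) \<bullet> (pos U i - z))
      = ?n * \<epsilon> * (w j * q j)" if "j \<in> J" for j
  proof -
    have r: "0 < r j"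
      using that by (auto simp: J_def r_def)
    have d: "deriv \<rho> (r j / \<epsilon>) = - (?n * \<epsilon> * \<xi> (r j / \<epsilon>) / r j)"
      using profile_pair_deriv[OF pp, of "r j / \<epsilon>"] r eps by (simp add: field_simps)
    have "(pos U j - pos U i) /\<^sub>R r j = (- inverse (r j)) *\<^sub>R (pos U i - pos U j)"
      by (simp add: algebra_simps)
    then have "Pr (plane U i) (plane U j) ((pos U j - pos U i) /\<^sub>R r j) \<bullet> (pos U i - z)
        = - (q j * r j)"
      using r unfolding q_def by (simp only: hom) (simp add: field_simps power2_eq_square)
    then show ?thesis
      using r by (simp add: d w_def)
  qed
  \<comment> \<open>Only pairs closer than \<epsilon> compete in the minimum; for the others the
    weight is zero.\<close>
  have le: "?c * w j \<le> w j * q j" if "j \<in> J" for j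
  proof (cases "r j < \<epsilon>")
    case True
    have "?c \<le> q j"
      using min_ratio_le[OF far, of j \<epsilon> Pr] that True
      by (auto simp: q_def r_def J_def norm_minus_commute)
    moreover have "0 \<le> w j"
      using mass[of j] xi_nonneg by (simp add: w_def)
    ultimately show ?thesis
      by (metis mult.commute mult_left_mono)
  next
    case False
    then have "\<xi> (r j / \<epsilon>) = 0"
      using pp eps by (intro profile_eq_0) (auto simp: profile_pair_def)
    then show ?thesis by (simp add: w_def)
  qed
  have "curv d \<epsilon> \<rho> \<xi> Pr U i \<bullet> (pos U i - z)
      = - (real d / (?n * \<epsilon>) * ((\<Sum>j\<in>J. (mass U j * deriv \<rho> (r j / \<epsilon>)) *
          (Pr (plane U i) (plane U j) ((pos U j - pos U i) /\<^sub>R r j) \<bullet> (pos U i - z))) / ?D))"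
    unfolding curv_def J_def r_def by (simp add: inner_sum_left divide_inverse)
  also have "\<dots> = - (real d * (\<Sum>j\<in>J. w j * q j) / ?D)"
    using eps by (simp add: summand flip: sum_distrib_left)
  also have "\<dots> \<le> - (real d * ?c)"
  proof -
    have "?c * ?D \<le> (\<Sum>j\<in>J. w j * q j)"
      unfolding D sum_distrib_left by (rule sum_mono) (rule le)
    then have "?c \<le> (\<Sum>j\<in>J. w j * q j) / ?D"
      using den by (simp add: field_simps)
    then show ?thesis
      using mult_left_mono[of ?c _ "real d"] by fastforce
  qed
  finally show ?thesis .
qed

lemma norm_le_max_radius: "norm (pos V i - z) \<le> max_radius z V"
  unfolding max_radius_def by (rule Max_ge) auto

lemma max_radius_attained:
  obtains i where "norm (pos V i - z) = max_radius z V"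
proof -
  have "max_radius z V \<in> range (\<lambda>i. norm (pos V i - z))"
    unfolding max_radius_def by (rule Max_in) auto
  then show ?thesis using that by auto
qed

lemma max_radius_step:
  fixes V W :: "('n::finite, 'm::finite) point_cloud"
  assumes "0 < \<epsilon>" "0 < \<tau>" "profile_pair CARD('n) \<rho> \<xi>" "Pr \<in> proj_choices"
    and V: "point_cloud_varifold d V"
    and step: "implicit_step d \<epsilon> \<rho> \<xi> Pr \<tau> V W"
  shows "(max_radius z W)\<^sup>2 \<le> (max_radius z V)\<^sup>2 - 2 * real d * \<tau> * min_ratio \<epsilon> Pr z (hat V W)"
proof -
  let ?U = "hat V W" and ?c = "min_ratio \<epsilon> Pr z (hat V W)"
  have U: "pos ?U = pos W" "mass ?U = mass V" "plane ?U = plane V"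
    by (simp_all add: hat_def)
  \<comment> \<open>The label is farthest in the new cloud, where the implicit scheme evaluates the
    curvature; in the old cloud it need not be farthest.\<close>
  obtain i where i: "norm (pos W i - z) = max_radius z W"
    using max_radius_attained .
  define h where "h = curv d \<epsilon> \<rho> \<xi> Pr ?U i"
  have "h \<bullet> (pos ?U i - z) \<le> - (real d * ?c)"
    unfolding h_def
  proof (rule curv_inner_le)
    show "norm (pos ?U i - z) = max_radius z ?U"
      using i by (simp add: max_radius_def U)
    show "Pr (plane ?U i) (plane ?U j) (a *\<^sub>R v) = a *\<^sub>R Pr (plane ?U i) (plane ?U j) v" for i j a v
      using V by (intro proj_choices_scaleR assms(4)) (simp_all add: U point_cloud_varifold_def)
    show "0 < mass ?U i" for i
      using V by (simp add: U point_cloud_varifold_def)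
    show "0 < curv_denom \<epsilon> \<xi> ?U i"
      using step by (simp add: implicit_step_def)
  qed (rule assms)+
  then have "2 * \<tau> * (h \<bullet> (pos W i - z)) \<le> - (2 * real d * \<tau> * ?c)"
    using mult_left_mono[of "h \<bullet> (pos W i - z)" "- (real d * ?c)" "2 * \<tau>"] assms(2)
    unfolding U by (simp only: mult_minus_right ac_simps)
  moreover have "(norm (pos V i - z))\<^sup>2
      = (norm (pos W i - z))\<^sup>2 - 2 * \<tau> * (h \<bullet> (pos W i - z)) + (norm (\<tau> *\<^sub>R h))\<^sup>2"
  proof -
    have "pos V i - z = (pos W i - z) - \<tau> *\<^sub>R h"
      using step by (simp add: implicit_step_def h_def)
    moreover have "(norm (y - \<tau> *\<^sub>R h))\<^sup>2 = (norm y)\<^sup>2 - 2 * \<tau> * (h \<bullet> y) + (norm (\<tau> *\<^sub>R h))\<^sup>2"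
      for y
      unfolding power2_norm_eq_inner by (simp add: inner_diff inner_commute)
    ultimately show ?thesis by (simp only:)
  qed
  moreover have "(norm (pos V i - z))\<^sup>2 \<le> (max_radius z V)\<^sup>2"
    by (intro power_mono norm_le_max_radius) simp
  ultimately show ?thesis
    unfolding i using zero_le_power2[of "norm (\<tau> *\<^sub>R h)"] by linarith
qed

theorem proposition5p4:
  fixes d :: nat and \<epsilon> \<tau> R0 :: real and \<rho> \<xi> :: "real \<Rightarrow> real"
    and Pr :: "(real ^ 'n) set \<Rightarrow> (real ^ 'n) set \<Rightarrow> real ^ 'n \<Rightarrow> real ^ 'n"
    and mass_rule :: "('m::finite \<Rightarrow> real ^ 'n) \<Rightarrow> 'm \<Rightarrow> real"
    and plane_rule :: "('m \<Rightarrow> real ^ 'n) \<Rightarrow> 'm \<Rightarrow> (real ^ 'n) set"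
    and V :: "nat \<Rightarrow> ('n::finite, 'm) point_cloud" and K :: enat
    and z :: "real ^ 'n" and c :: "nat \<Rightarrow> real"
  assumes "1 \<le> d" and "d \<le> CARD('n)" and "0 < \<epsilon>" and "0 < \<tau>"
    and "profile_pair CARD('n) \<rho> \<xi>"
    and "Pr \<in> proj_choices"
    and "\<And>k. enat k \<le> K \<Longrightarrow> point_cloud_varifold d (V k)"
    and "\<And>k. enat k \<le> K \<Longrightarrow> mass (V k) = mass_rule (pos (V k))"
    and "\<And>k. enat k \<le> K \<Longrightarrow> plane (V k) = plane_rule (pos (V k))"
    and "\<And>k. enat (Suc k) \<le> K \<Longrightarrow> implicit_step d \<epsilon> \<rho> \<xi> Pr \<tau> (V k) (V (Suc k))"
    and "\<And>i. pos (V 0) i \<in> cball z R0"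
    and "\<And>k. enat (Suc k) \<le> K \<Longrightarrow> c k = min_ratio \<epsilon> Pr z (hat (V k) (V (Suc k)))"
  shows "\<forall>k. enat k \<le> K \<longrightarrow>
           (\<forall>j. pos (V k) j \<in> cball z (sqrt (R0\<^sup>2 - 2 * real d * \<tau> * (\<Sum>l<k. c l))))"
proof (intro allI impI)
  fix k j
  assume k: "enat k \<le> K"
  \<comment> \<open>Induction on squared radii lets the one-step bounds telescope without any sign
    condition on c.\<close>
  have "(max_radius z (V k))\<^sup>2 \<le> R0\<^sup>2 - 2 * real d * \<tau> * (\<Sum>l<k. c l)"
    using k
  proof (induction k)
    case 0
    obtain i where "norm (pos (V 0) i - z) = max_radius z (V 0)"
      using max_radius_attained .
    with assms(11)[of i] have "(max_radius z (V 0))\<^sup>2 \<le> R0\<^sup>2"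
      by (metis dist_commute dist_norm mem_cball norm_ge_zero power_mono)
    then show ?case by simp
  next
    case (Suc k)
    then have "enat k \<le> K"
      by (meson Suc_ile_eq less_imp_le)
    then have "(max_radius z (V k))\<^sup>2 \<le> R0\<^sup>2 - 2 * real d * \<tau> * (\<Sum>l<k. c l)"
      and "(max_radius z (V (Suc k)))\<^sup>2 \<le> (max_radius z (V k))\<^sup>2 - 2 * real d * \<tau> * c k"
      using Suc max_radius_step[OF assms(3-6) assms(7) assms(10), of k z] assms(12)[of k] by auto
    then show ?case by (simp add: algebra_simps)
  qed
  moreover have "(norm (pos (V k) j - z))\<^sup>2 \<le> (max_radius z (V k))\<^sup>2"
    by (intro power_mono norm_le_max_radius) simp
  \<comment> \<open>The radicand dominates a square, hence is nonnegative and the root is a genuine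
    radius.\<close>
  ultimately have "norm (pos (V k) j - z) \<le> sqrt (R0\<^sup>2 - 2 * real d * \<tau> * (\<Sum>l<k. c l))"
    by (intro real_le_rsqrt) simp
  then show "pos (V k) j \<in> cball z (sqrt (R0\<^sup>2 - 2 * real d * \<tau> * (\<Sum>l<k. c l)))"
    by (simp add: dist_norm norm_minus_commute)
qed

end
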